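(* Let $\mathcal{M}_1,\mathcal{M}_2$ be $q$-matroids over $\mathbb{F}_q$ (on finite-dimensional ground spaces) with projectivizations $\mathbb{P}\mathcal{M}_1,\mathbb{P}\mathcal{M}_2$. The Whitney functions of $\mathcal{M}$ and $\mathbb{P}\mathcal{M}$ determine each other; that is, $R_{\mathcal{M}_1}=R_{\mathcal{M}_2}$ if and only if $R_{\mathbb{P}\mathcal{M}_1}=R_{\mathbb{P}\mathcal{M}_2}$.
   Context: A $q$-matroid on a finite-dimensional $\mathbb{F}_q$-vector space $E$ is $(E,\rho)$ with $\rho$ from the subspaces of $E$ to $\mathbb{N}_0$ satisfying $0\le\rho(V)\le\dim V$, $V\le W\Rightarrow\rho(V)\le\rho(W)$, and $\rho(V+W)+\rho(V\cap W)\le\rho(V)+\rho(W)$. Its Whitney function is $R_{\mathcal{M}}=\sum_{V\le E}x^{\rho(E)-\rho(V)}y^{\dim V-\rho(V)}$. The projectivization $\mathbb{P}\mathcal{M}$ is the matroid on the set $\mathbb{P}E$ of one-dimensional subspaces of $E$ with rank function $r(A)=\rho(\langle A\rangle)$, where $\langle A\rangle$ is the subspace spanned by the lines in $A$. The Whitney function of a matroid $(S,r)$ is $R=\sum_{A\subseteq S}x^{r(S)-r(A)}y^{|A|-r(A)}$. *)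

theory Defs
  imports "HOL-Computational_Algebra.Polynomial" "HOL-Library.FuncSet"
begin

text \<open>A polynomial in \<open>x\<close> and \<open>y\<close> is an element of \<open>int poly poly\<close>: the outer
  indeterminate is \<open>x\<close>, the inner one is \<open>y\<close>.\<close>

definition monom_xy :: "nat \<Rightarrow> nat \<Rightarrow> int poly poly" where
  "monom_xy i j = monom (monom 1 j) i"

locale matroid =
  fixes S :: "'e set" and r :: "'e set \<Rightarrow> nat"
  assumes finite_ground: "finite S"
    and rank_le_card: "A \<subseteq> S \<Longrightarrow> r A \<le> card A"
    and rank_mono: "A \<subseteq> B \<Longrightarrow> B \<subseteq> S \<Longrightarrow> r A \<le> r B"
    and rank_submodular: "A \<subseteq> S \<Longrightarrow> B \<subseteq> S \<Longrightarrow> r (A \<union> B) + r (A \<inter> B) \<le> r A + r B"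

text \<open>For a matroid, and for a \<open>q\<close>-matroid below, the natural number subtractions in the
  exponents never truncate.\<close>

definition whitney :: "'e set \<Rightarrow> ('e set \<Rightarrow> nat) \<Rightarrow> int poly poly" where
  "whitney S r = (\<Sum>A\<in>Pow S. monom_xy (r S - r A) (card A - r A))"

text \<open>The ground space \<open>E\<close> is a finite-dimensional subspace of an ambient vector space over the
  finite field \<open>'a\<close>; the ambient space itself, when finite-dimensional, is the case
  \<open>E = UNIV\<close>. Only the values of \<open>\<rho>\<close> on subspaces of \<open>E\<close> are meaningful.\<close>

locale q_matroid = vector_space scale
  for scale :: "'a::{field, finite} \<Rightarrow> 'b::ab_group_add \<Rightarrow> 'b" +
  fixes E :: "'b set" and \<rho> :: "'b set \<Rightarrow> nat"
  assumes subspace_ground: "subspace E"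
    and finite_dim_ground: "\<exists>B. finite B \<and> span B = E"
    and rank_le_dim: "subspace V \<Longrightarrow> V \<subseteq> E \<Longrightarrow> \<rho> V \<le> dim V"
    and rank_mono: "subspace V \<Longrightarrow> subspace W \<Longrightarrow> V \<subseteq> W \<Longrightarrow> W \<subseteq> E \<Longrightarrow> \<rho> V \<le> \<rho> W"
    and rank_submodular: "subspace V \<Longrightarrow> V \<subseteq> E \<Longrightarrow> subspace W \<Longrightarrow> W \<subseteq> E \<Longrightarrow>
      \<rho> {v + w | v w. v \<in> V \<and> w \<in> W} + \<rho> (V \<inter> W) \<le> \<rho> V + \<rho> W"

context vector_space
begin

definition q_whitney :: "'b set \<Rightarrow> ('b set \<Rightarrow> nat) \<Rightarrow> int poly poly" where
  "q_whitney E \<rho> =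
    (\<Sum>V\<in>{V. subspace V \<and> V \<subseteq> E}. monom_xy (\<rho> E - \<rho> V) (dim V - \<rho> V))"

definition proj_space :: "'b set \<Rightarrow> 'b set set" where
  "proj_space E = {L. subspace L \<and> L \<subseteq> E \<and> dim L = 1}"

definition proj_rank :: "('b set \<Rightarrow> nat) \<Rightarrow> 'b set set \<Rightarrow> nat" where
  "proj_rank \<rho> A = \<rho> (span (\<Union>A))"

end

context q_matroid
begin

lemma finite_E: "finite E"
proof -
  obtain B where B: "finite B" "span B = E" using finite_dim_ground by blast
  have "E \<subseteq> (\<lambda>u. \<Sum>v\<in>B. scale (u v) v) ` (PiE B (\<lambda>_. UNIV))"
  proof
    fix x assume "x \<in> E"
    then obtain u where u: "x = (\<Sum>v\<in>B. scale (u v) v)"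
      using span_finite[OF B(1)] unfolding B(2) by blast
    have "x = (\<Sum>v\<in>B. scale (restrict u B v) v)" unfolding u by (rule sum.cong) auto
    then show "x \<in> (\<lambda>u. \<Sum>v\<in>B. scale (u v) v) ` (PiE B (\<lambda>_. UNIV))"
      by (rule image_eqI[where x = "restrict u B"]) simp
  qed
  moreover have "finite (PiE B (\<lambda>_. UNIV :: 'a set))"
    using B(1) by (intro finite_PiE) simp_all
  ultimately show ?thesis by (rule finite_surj[rotated])
qed

theorem matroid_projectivization: "matroid (proj_space E) (proj_rank \<rho>)"
proof
  show fin: "finite (proj_space E)"
    by (rule finite_subset[of _ "Pow E"]) (auto simp: proj_space_def finite_E)
  have sub: "span (\<Union>A) \<subseteq> E" if "A \<subseteq> proj_space E" for A
    by (rule span_minimal) (use that subspace_ground in \<open>auto simp: proj_space_def\<close>)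
  show "proj_rank \<rho> A \<le> card A" if A: "A \<subseteq> proj_space E" for A
  proof -
    have "\<exists>v. L \<subseteq> span {v}" if "L \<in> A" for L
    proof -
      from that A have L: "dim L = 1" by (auto simp: proj_space_def)
      obtain C where C: "C \<subseteq> L" "independent C" "L \<subseteq> span C" "card C = dim L"
        using basis_exists[of L] by blast
      with L have "card C = 1" by simp
      then obtain v where "C = {v}" by (rule card_1_singletonE)
      with C show ?thesis by blast
    qed
    then have "\<forall>L\<in>A. \<exists>v. L \<subseteq> span {v}" by blast
    from bchoice[OF this] obtain f where f: "\<And>L. L \<in> A \<Longrightarrow> L \<subseteq> span {f L}" by blast
    have finA: "finite A" using A fin finite_subset by blast
    have "span {f L} \<subseteq> span (f ` A)" if "L \<in> A" for L
      using that by (intro span_mono) auto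
    with f have "\<Union>A \<subseteq> span (f ` A)" by blast
    then have "span (\<Union>A) \<subseteq> span (f ` A)" by (rule span_minimal) simp
    then have "dim (span (\<Union>A)) \<le> card (f ` A)"
      by (rule dim_le_card) (simp add: finA)
    also have "\<dots> \<le> card A" using finA by (rule card_image_le)
    finally show ?thesis
      using rank_le_dim[OF subspace_span sub[OF A]] unfolding proj_rank_def by linarith
  qed
  show "proj_rank \<rho> A \<le> proj_rank \<rho> B" if "A \<subseteq> B" "B \<subseteq> proj_space E" for A B
    unfolding proj_rank_def
    using that
    by (intro rank_mono subspace_span sub span_mono Union_mono)
  show "proj_rank \<rho> (A \<union> B) + proj_rank \<rho> (A \<inter> B) \<le> proj_rank \<rho> A + proj_rank \<rho> B"
    if A: "A \<subseteq> proj_space E" and B: "B \<subseteq> proj_space E" for A B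
  proof -
    let ?V = "span (\<Union>A)" and ?W = "span (\<Union>B)"
    have "span (\<Union>(A \<union> B)) = {v + w | v w. v \<in> ?V \<and> w \<in> ?W}"
      unfolding Union_Un_distrib by (rule span_Un)
    moreover have "\<rho> (span (\<Union>(A \<inter> B))) \<le> \<rho> (?V \<inter> ?W)"
    proof (rule rank_mono)
      show "span (\<Union>(A \<inter> B)) \<subseteq> ?V \<inter> ?W"
        using span_mono[of "\<Union>(A \<inter> B)" "\<Union>A"] span_mono[of "\<Union>(A \<inter> B)" "\<Union>B"] by blast
      show "?V \<inter> ?W \<subseteq> E" using sub[OF A] by blast
    qed (intro subspace_inter subspace_span)+
    moreover note rank_submodular[OF subspace_span sub[OF A] subspace_span sub[OF B]]
    ultimately show ?thesis unfolding proj_rank_def by simp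
  qed
qed

end

end

theory Submission
  imports Defs
begin

text \<open>
  Both Whitney functions record the joint distribution of rank and size (dimension, respectively
  cardinality): total rank and truncation-free exponents can be read off the polynomial because a
  rank 0 member and the top member always occur. Grouping the sets of points by their span, the
  numbers \<open>P(r,k)\<close> of \<open>k\<close>-sets of points of rank \<open>r\<close> and \<open>C(r,d)\<close> of \<open>d\<close>-dimensional subspaces
  of rank \<open>r\<close> satisfy \<open>P(r,k) = \<Sum>\<^sub>d C(r,d) s(d,k)\<close>, where \<open>s(d,k)\<close> is the number of spanning
  \<open>k\<close>-sets of points of a \<open>d\<close>-dimensional space. A \<open>d\<close>-dimensional space has \<open>\<pi>(d)\<close> points with \<open>\<pi>\<close>
  strictly increasing, so the columns \<open>k = \<pi>(d)\<close> of \<open>s\<close> form a unitriangular matrix, and \<open>C\<close> can be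
  recovered from \<open>P\<close>.
\<close>

section \<open>Reading joint rank and size counts off Whitney polynomials\<close>

lemma coeff_sum_monom_xy:
  assumes "finite X"
  shows "coeff (coeff (\<Sum>a\<in>X. monom_xy (f a) (g a)) i) j = int (card {a\<in>X. f a = i \<and> g a = j})"
proof -
  have "coeff (coeff (\<Sum>a\<in>X. monom_xy (f a) (g a)) i) j =
      (\<Sum>a\<in>X. if f a = i \<and> g a = j then 1 else 0)"
    unfolding coeff_sum by (rule sum.cong) (auto simp: monom_xy_def)
  also have "\<dots> = int (card {a\<in>X. f a = i \<and> g a = j})"
    using assms by (simp flip: sum.inter_filter)
  finally show ?thesis .
qed

lemma sum_monom_xy_eq_iff:
  assumes "finite X" "finite Y"
  shows "(\<Sum>a\<in>X. monom_xy (f a) (g a)) = (\<Sum>b\<in>Y. monom_xy (f' b) (g' b)) \<longleftrightarrow>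
    (\<forall>i j. card {a\<in>X. f a = i \<and> g a = j} = card {b\<in>Y. f' b = i \<and> g' b = j})"
  by (simp add: poly_eq_iff coeff_sum_monom_xy assms)

lemma card_filter_eq_imp_ex:
  assumes "finite X" "card {a\<in>X. P a} = card {b\<in>Y. Q b}" "a \<in> X" "P a"
  shows "\<exists>b\<in>Y. Q b"
proof -
  have "card {a\<in>X. P a} \<noteq> 0" using assms(1,3,4) by auto
  then have "{b\<in>Y. Q b} \<noteq> {}" using assms(2) by fastforce
  then show ?thesis by blast
qed

text \<open>The exponents show only corank and nullity, so the point is to recover the total rank
  \<open>rk t\<close>; after that, both sides carry the same data up to a change of indices. Stated
  for arbitrary families so that it covers both subspaces with dimension and point sets with
  cardinality.\<close>

lemma whitney_sum_eq_iff:
  fixes rk sz :: "'x \<Rightarrow> nat" and rk' sz' :: "'y \<Rightarrow> nat"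
  assumes fin: "finite X" "finite Y"
    and top: "t \<in> X" "t' \<in> Y"
    and le_top: "\<And>a. a \<in> X \<Longrightarrow> rk a \<le> rk t" "\<And>b. b \<in> Y \<Longrightarrow> rk' b \<le> rk' t'"
    and le_size: "\<And>a. a \<in> X \<Longrightarrow> rk a \<le> sz a" "\<And>b. b \<in> Y \<Longrightarrow> rk' b \<le> sz' b"
    and bot: "o1 \<in> X" "rk o1 = 0" "o2 \<in> Y" "rk' o2 = 0"
  shows "(\<Sum>a\<in>X. monom_xy (rk t - rk a) (sz a - rk a)) =
      (\<Sum>b\<in>Y. monom_xy (rk' t' - rk' b) (sz' b - rk' b)) \<longleftrightarrow>
    (\<forall>r d. card {a\<in>X. rk a = r \<and> sz a = d} = card {b\<in>Y. rk' b = r \<and> sz' b = d})"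
    (is "?sum = ?sum' \<longleftrightarrow> ?cnt")
proof
  assume "?sum = ?sum'"
  then have eq: "card {a\<in>X. rk t - rk a = i \<and> sz a - rk a = j} =
      card {b\<in>Y. rk' t' - rk' b = i \<and> sz' b - rk' b = j}" for i j
    unfolding sum_monom_xy_eq_iff[OF fin] by blast
  \<comment> \<open>A member of rank 0 has corank \<open>rk t\<close>. Its counterpart in
    \<open>Y\<close> forces \<open>rk t \<le> rk' t'\<close>; the next step is the mirror
    image.\<close>
  have "\<exists>b\<in>Y. rk' t' - rk' b = rk t \<and> sz' b - rk' b = sz o1"
    by (rule card_filter_eq_imp_ex[OF fin(1) eq bot(1)]) (simp add: bot)
  moreover have "\<exists>a\<in>X. rk t - rk a = rk' t' \<and> sz a - rk a = sz' o2"
    by (rule card_filter_eq_imp_ex[OF fin(2) eq[symmetric] bot(3)]) (simp add: bot)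
  ultimately have R: "rk' t' = rk t" by auto
  show ?cnt
  proof (intro allI)
    fix r d
    show "card {a\<in>X. rk a = r \<and> sz a = d} = card {b\<in>Y. rk' b = r \<and> sz' b = d}"
    \<comment> \<open>Only in this range do \<open>rk t - r\<close> and \<open>d - r\<close> avoid
      truncation; outside it no member has rank \<open>r\<close> and size \<open>d\<close>.\<close>
    proof (cases "r \<le> rk t \<and> r \<le> d")
      case True
      have "{a\<in>X. rk a = r \<and> sz a = d} = {a\<in>X. rk t - rk a = rk t - r \<and> sz a - rk a = d - r}"
        using True le_top(1) le_size(1) by fastforce
      moreover have "{b\<in>Y. rk' b = r \<and> sz' b = d} =
          {b\<in>Y. rk' t' - rk' b = rk t - r \<and> sz' b - rk' b = d - r}"
        using True le_top(2) le_size(2) R by fastforce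
      ultimately show ?thesis using eq by simp
    next
      case False
      then have "{a\<in>X. rk a = r \<and> sz a = d} = {}" "{b\<in>Y. rk' b = r \<and> sz' b = d} = {}"
        using le_top le_size R by auto
      then show ?thesis by (simp only: card.empty)
    qed
  qed
next
  assume cnt: ?cnt
  \<comment> \<open>The rank of each top member occurs in the other family, hence is bounded by the
    other top rank.\<close>
  have "\<exists>b\<in>Y. rk' b = rk t \<and> sz' b = sz t"
    by (rule card_filter_eq_imp_ex[OF fin(1) cnt[rule_format] top(1)]) simp
  moreover have "\<exists>a\<in>X. rk a = rk' t' \<and> sz a = sz' t'"
    by (rule card_filter_eq_imp_ex[OF fin(2) cnt[rule_format, symmetric] top(2)]) simp
  ultimately have R: "rk' t' = rk t" using le_top by (metis le_antisym)
  show "?sum = ?sum'"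
    unfolding sum_monom_xy_eq_iff[OF fin]
  proof (intro allI)
    fix i j
    show "card {a\<in>X. rk t - rk a = i \<and> sz a - rk a = j} =
        card {b\<in>Y. rk' t' - rk' b = i \<and> sz' b - rk' b = j}"
    proof (cases "i \<le> rk t")
      case True
      have "{a\<in>X. rk t - rk a = i \<and> sz a - rk a = j} =
          {a\<in>X. rk a = rk t - i \<and> sz a = j + (rk t - i)}"
        using True le_top(1) le_size(1) by fastforce
      moreover have "{b\<in>Y. rk' t' - rk' b = i \<and> sz' b - rk' b = j} =
          {b\<in>Y. rk' b = rk t - i \<and> sz' b = j + (rk t - i)}"
        using True le_top(2) le_size(2) R by fastforce
      ultimately show ?thesis using cnt by simp
    next
      case False
      then have "{a\<in>X. rk t - rk a = i \<and> sz a - rk a = j} = {}"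
          "{b\<in>Y. rk' t' - rk' b = i \<and> sz' b - rk' b = j} = {}"
        using R by auto
      then show ?thesis by (simp only: card.empty)
    qed
  qed
qed

section \<open>Inverting a unitriangular system\<close>

text \<open>Back substitution from \<open>d = N\<close> downwards: in column \<open>\<pi> d\<close>
  the rows below \<open>d\<close> vanish, row \<open>d\<close> contributes \<open>u d\<close>
  itself, and the rows above \<open>d\<close> agree by induction.\<close>

lemma unitriangular_cancel:
  fixes u v :: "nat \<Rightarrow> nat" and s :: "nat \<Rightarrow> nat \<Rightarrow> nat"
  assumes eq: "\<And>k. (\<Sum>d\<le>N. u d * s d k) = (\<Sum>d\<le>N. v d * s d k)"
    and one: "\<And>d. d \<le> N \<Longrightarrow> s d (\<pi> d) = 1"
    and zero: "\<And>d e. e < d \<Longrightarrow> d \<le> N \<Longrightarrow> s e (\<pi> d) = 0"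
  shows "d \<le> N \<Longrightarrow> u d = v d"
proof (induction "N - d" arbitrary: d rule: less_induct)
  case less
  have split: "(\<Sum>e\<le>N. w e * s e (\<pi> d)) = w d + (\<Sum>e\<in>{d<..N}. w e * s e (\<pi> d))" for w
  proof -
    have "(\<Sum>e\<le>N. w e * s e (\<pi> d)) = (\<Sum>e\<in>insert d {d<..N}. w e * s e (\<pi> d))"
      by (rule sum.mono_neutral_right) (use less.prems zero in \<open>auto simp: not_less\<close>)
    then show ?thesis using less.prems by (simp add: one)
  qed
  have "(\<Sum>e\<in>{d<..N}. u e * s e (\<pi> d)) = (\<Sum>e\<in>{d<..N}. v e * s e (\<pi> d))"
  proof (rule sum.cong)
    fix e assume "e \<in> {d<..N}"
    then have "u e = v e" by (intro less.hyps) auto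
    then show "u e * s e (\<pi> d) = v e * s e (\<pi> d)" by simp
  qed simp
  then show ?case using eq[of "\<pi> d"] unfolding split by simp
qed

section \<open>Points of a space and spanning sets of points\<close>

text \<open>Attached to a space \<open>V\<close> instead of a dimension;
  \<open>spanning_count_eq\<close> shows that for finite subspaces over the same field only the
  dimension matters.\<close>

definition (in vector_space) spanning_count :: "'b set \<Rightarrow> nat \<Rightarrow> nat" where
  "spanning_count V k = card {A. A \<subseteq> proj_space V \<and> card A = k \<and> span (\<Union>A) = V}"

lemma (in vector_space) finite_proj_space: "finite V \<Longrightarrow> finite (proj_space V)"
  by (rule finite_subset[of _ "Pow V"]) (auto simp: proj_space_def)

lemma (in vector_space) proj_space_mono: "V \<subseteq> W \<Longrightarrow> proj_space V \<subseteq> proj_space W"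
  by (auto simp: proj_space_def)

lemma (in vector_space) span_singleton_in_proj_space:
  assumes "subspace V" "v \<in> V" "v \<noteq> 0"
  shows "span {v} \<in> proj_space V"
proof -
  have "independent {v}" using assms(3) by simp
  then have "dim (span {v}) = 1" by (subst dim_span_eq_card_independent) simp_all
  moreover have "span {v} \<subseteq> V" by (rule span_minimal) (use assms in auto)
  ultimately show ?thesis by (simp add: proj_space_def)
qed

lemma (in vector_space) span_Union_proj_space:
  assumes "subspace V"
  shows "span (\<Union>(proj_space V)) = V"
proof
  show "span (\<Union>(proj_space V)) \<subseteq> V"
    by (rule span_minimal) (use assms in \<open>auto simp: proj_space_def\<close>)
  show "V \<subseteq> span (\<Union>(proj_space V))"
  proof
    fix v assume v: "v \<in> V"
    show "v \<in> span (\<Union>(proj_space V))"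
    proof (cases "v = 0")
      case False
      then have "v \<in> \<Union>(proj_space V)"
        using span_singleton_in_proj_space[OF assms v] span_base[of v "{v}"] by blast
      then show ?thesis by (rule span_base)
    qed (simp add: span_zero)
  qed
qed

text \<open>A subspace is the span of its points, so distinct subspaces have distinct point sets.
  This gives the strict growth of the number of points.\<close>

lemma (in vector_space) card_proj_space_less:
  assumes "finite W" "subspace V" "subspace W" "V \<subset> W"
  shows "card (proj_space V) < card (proj_space W)"
proof (rule psubset_card_mono[OF finite_proj_space[OF assms(1)]])
  have "proj_space V \<noteq> proj_space W"
    using assms(4) span_Union_proj_space[OF assms(2)] span_Union_proj_space[OF assms(3)]
    by (metis psubset_eq)
  then show "proj_space V \<subset> proj_space W" using proj_space_mono assms(4) by blast
qed

text \<open>The full point set is the only candidate of this size, and it spans. This is the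
  diagonal entry of the matrix.\<close>

lemma (in vector_space) spanning_count_card_proj_space:
  assumes "finite V" "subspace V"
  shows "spanning_count V (card (proj_space V)) = 1"
proof -
  have "{A. A \<subseteq> proj_space V \<and> card A = card (proj_space V) \<and> span (\<Union>A) = V} = {proj_space V}"
    using card_subset_eq[OF finite_proj_space[OF assms(1)]] span_Union_proj_space[OF assms(2)]
    by blast
  then show ?thesis unfolding spanning_count_def by (simp only:) simp
qed

lemma (in vector_space) spanning_count_eq_0:
  assumes "finite V" "card (proj_space V) < k"
  shows "spanning_count V k = 0"
proof -
  have "{A. A \<subseteq> proj_space V \<and> card A = k \<and> span (\<Union>A) = V} = {}"
    using card_mono[OF finite_proj_space[OF assms(1)]] assms(2) leD by blast
  then show ?thesis unfolding spanning_count_def by (simp only: card.empty)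
qed

lemma (in vector_space) dim_le_dim_finite:
  assumes "finite W" "V \<subseteq> W"
  shows "dim V \<le> dim W"
proof -
  obtain C where C: "C \<subseteq> W" "independent C" "W \<subseteq> span C" "card C = dim W"
    using basis_exists[of W] by blast
  show ?thesis
    using dim_le_card[OF order_trans[OF assms(2) C(3)] finite_subset[OF C(1) assms(1)]] C(4)
    by simp
qed

text \<open>Spans of the initial segments of an enumerated basis. The chain provides one test space
  for each dimension, nested so that their numbers of points can be compared.\<close>

lemma (in vector_space) subspace_chain_exists:
  assumes "finite E" "subspace E"
  obtains V where "\<And>d. d \<le> dim E \<Longrightarrow> subspace (V d) \<and> V d \<subseteq> E \<and> dim (V d) = d"
    and "\<And>d e. d < e \<Longrightarrow> e \<le> dim E \<Longrightarrow> V d \<subset> V e"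
proof -
  obtain B where B: "B \<subseteq> E" "independent B" "E \<subseteq> span B" "card B = dim E"
    using basis_exists[of E] by blast
  have "finite B" by (rule finite_subset[OF B(1) assms(1)])
  then obtain b where b: "bij_betw b {0..<dim E} B"
    using ex_bij_betw_nat_finite B(4) by metis
  define V where "V d = span (b ` {0..<d})" for d
  have V: "subspace (V d) \<and> V d \<subseteq> E \<and> dim (V d) = d" if "d \<le> dim E" for d
  proof -
    have le: "{0..<d} \<subseteq> {0..<dim E}" using that by simp
    have sub: "b ` {0..<d} \<subseteq> B" using b le unfolding bij_betw_def by blast
    have inj: "inj_on b {0..<d}" using b le unfolding bij_betw_def by (blast intro: inj_on_subset)
    have "dim (V d) = card (b ` {0..<d})"
      unfolding V_def by (intro dim_span_eq_card_independent independent_mono[OF B(2) sub])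
    also have "\<dots> = d" using inj by (simp add: card_image)
    finally have "dim (V d) = d" .
    moreover have "V d \<subseteq> E"
      unfolding V_def using sub B(1) assms(2) by (intro span_minimal) auto
    ultimately show ?thesis by (simp add: V_def)
  qed
  have "V d \<subset> V e" if "d < e" "e \<le> dim E" for d e
  proof (rule psubsetI)
    show "V d \<subseteq> V e" unfolding V_def using that by (intro span_mono image_mono) auto
    show "V d \<noteq> V e" using V[of d] V[of e] that by (metis less_imp_le less_irrefl order_trans)
  qed
  with V show ?thesis by (rule that)
qed

section \<open>Spanning counts depend only on the dimension\<close>

text \<open>A linear bijection from \<open>V\<close> onto \<open>W\<close> maps points to points and
  spanning sets to spanning sets, injectively. An inequality suffices, since the hypotheses are
  symmetric in the two spaces.\<close>

lemma spanning_count_le: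
  fixes s1 :: "'a::field \<Rightarrow> 'b::ab_group_add \<Rightarrow> 'b" and s2 :: "'a \<Rightarrow> 'c::ab_group_add \<Rightarrow> 'c"
  assumes vs: "vector_space s1" "vector_space s2"
    and fin: "finite V" "finite W"
    and sub: "module.subspace s1 V" "module.subspace s2 W"
    and dim: "vector_space.dim s1 V = vector_space.dim s2 W"
  shows "vector_space.spanning_count s1 V k \<le> vector_space.spanning_count s2 W k"
proof -
  interpret vs1: vector_space s1 by fact
  interpret vs2: vector_space s2 by fact
  interpret pair: vector_space_pair s1 s2 by unfold_locales
  obtain B where B: "B \<subseteq> V" "vs1.independent B" "V \<subseteq> vs1.span B" "card B = vs1.dim V"
    using vs1.basis_exists[of V] by blast
  obtain C where C: "C \<subseteq> W" "vs2.independent C" "W \<subseteq> vs2.span C" "card C = vs2.dim W"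
    using vs2.basis_exists[of W] by blast
  have "finite B" "finite C"
    using finite_subset[OF B(1) fin(1)] finite_subset[OF C(1) fin(2)] by simp_all
  \<comment> \<open>\<open>f\<close> is linear on the whole ambient space, but injectivity is only
    known on \<open>V\<close>; hence the restrictions to \<open>V\<close> below.\<close>
  from pair.finite_basis_to_basis_subspace_isomorphism[OF sub dim this(1) B this(2) C]
  obtain f where f: "Vector_Spaces.linear s1 s2 f" "f ` V = W" "inj_on f V" by blast
  have line: "f ` L \<in> vs2.proj_space W" if "L \<in> vs1.proj_space V" for L
  proof -
    have L: "vs1.subspace L" "L \<subseteq> V" "vs1.dim L = 1"
      using that by (auto simp: vs1.proj_space_def)
    obtain D where D: "D \<subseteq> L" "vs1.independent D" "L \<subseteq> vs1.span D" "card D = vs1.dim L"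
      using vs1.basis_exists[of L] by blast
    have spD: "vs1.span D = L" using vs1.span_subspace[OF D(1,3) L(1)] .
    have inj: "inj_on f L" using f(3) L(2) by (rule inj_on_subset)
    have "vs2.dim (f ` L) = 1"
    proof (rule vs2.dim_unique)
      show "f ` D \<subseteq> f ` L" using D(1) by blast
      show "f ` L \<subseteq> vs2.span (f ` D)" by (simp add: pair.linear_span_image[OF f(1)] spD)
      show "vs2.independent (f ` D)"
        using pair.linear_independent_injective_image[OF f(1) D(2)] inj spD by simp
      show "card (f ` D) = 1"
        using card_image[OF inj_on_subset[OF inj D(1)]] D(4) L(3) by simp
    qed
    then show ?thesis
      using pair.linear_subspace_image[OF f(1) L(1)] L(2) f(2) by (auto simp: vs2.proj_space_def)
  qed
  \<comment> \<open>Point sets are sets of sets of vectors, so injectivity on \<open>V\<close> is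
    lifted through two power sets.\<close>
  have inj_sets: "inj_on ((`) ((`) f)) (Pow (Pow V))"
    by (intro inj_on_image_Pow f)
  have Pow: "vs1.proj_space V \<subseteq> Pow V" by (auto simp: vs1.proj_space_def)
  let ?S = "{A. A \<subseteq> vs1.proj_space V \<and> card A = k \<and> vs1.span (\<Union>A) = V}"
  let ?T = "{A. A \<subseteq> vs2.proj_space W \<and> card A = k \<and> vs2.span (\<Union>A) = W}"
  have "card ?S \<le> card ?T"
  proof (rule card_inj_on_le)
    show "inj_on ((`) ((`) f)) ?S"
      by (rule inj_on_subset[OF inj_sets]) (use Pow in blast)
    show "finite ?T"
      by (rule finite_subset[of _ "Pow (vs2.proj_space W)"])
        (auto simp: vs2.finite_proj_space fin)
    show "(`) ((`) f) ` ?S \<subseteq> ?T"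
    proof
      fix A' assume "A' \<in> (`) ((`) f) ` ?S"
      then obtain A where A: "A' = (`) f ` A" "A \<subseteq> vs1.proj_space V" "card A = k"
          "vs1.span (\<Union>A) = V" by blast
      have "inj_on ((`) f) A"
        using inj_on_subset[OF inj_on_image_Pow[OF f(3)]] Pow A(2) by blast
      then have "card A' = k" using A by (simp add: card_image)
      moreover have "vs2.span (\<Union>A') = W"
        using A pair.linear_span_image[OF f(1), of "\<Union>A"] f(2) by (simp add: image_Union)
      moreover have "A' \<subseteq> vs2.proj_space W" using A line by blast
      ultimately show "A' \<in> ?T" by blast
    qed
  qed
  then show ?thesis unfolding vs1.spanning_count_def vs2.spanning_count_def .
qed

lemma spanning_count_eq:
  fixes s1 :: "'a::field \<Rightarrow> 'b::ab_group_add \<Rightarrow> 'b" and s2 :: "'a \<Rightarrow> 'c::ab_group_add \<Rightarrow> 'c"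
  assumes "vector_space s1" "vector_space s2" "finite V" "finite W"
    and "module.subspace s1 V" "module.subspace s2 W"
    and "vector_space.dim s1 V = vector_space.dim s2 W"
  shows "vector_space.spanning_count s1 V k = vector_space.spanning_count s2 W k"
  using assms by (intro le_antisym spanning_count_le) simp_all

section \<open>Grouping point sets of a q-matroid by their span\<close>

context q_matroid
begin

text \<open>The nested comprehension here, and the membership in \<open>Pow\<close> in
  \<open>point_set_count\<close>, match the filtered sets in
  \<open>whitney_sum_eq_iff\<close>.\<close>

definition subspace_count :: "nat \<Rightarrow> nat \<Rightarrow> nat" where
  "subspace_count r d = card {V \<in> {V. subspace V \<and> V \<subseteq> E}. \<rho> V = r \<and> dim V = d}"

definition point_set_count :: "nat \<Rightarrow> nat \<Rightarrow> nat" where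
  "point_set_count r k = card {A \<in> Pow (proj_space E). proj_rank \<rho> A = r \<and> card A = k}"

lemma finite_subspaces: "finite {V. subspace V \<and> V \<subseteq> E}"
  by (rule finite_subset[of _ "Pow E"]) (auto simp: finite_E)

lemma rank_zero: "\<rho> {0} = 0"
proof -
  have "dim {0} = 0" using dim_span[of "{}"] dim_eq_card_independent[of "{}"]
    by (simp add: independent_empty)
  then show ?thesis
    using rank_le_dim[of "{0}"] subspace_0[OF subspace_ground] by (simp add: subspace_single_0)
qed

lemma subspace_count_eq_0:
  assumes "dim E < d"
  shows "subspace_count r d = 0"
proof -
  have "{V \<in> {V. subspace V \<and> V \<subseteq> E}. \<rho> V = r \<and> dim V = d} = {}"
    using dim_le_dim_finite[OF finite_E] assms leD by blast
  then show ?thesis unfolding subspace_count_def by (simp only: card.empty)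
qed

text \<open>The projective rank of a point set is by definition the rank of its span, so point sets
  can be grouped by span and the spans by dimension. The bound \<open>N\<close> may exceed
  \<open>dim E\<close>, which lets two ground spaces share one range of summation.\<close>

lemma point_set_count_eq_sum:
  assumes s: "\<And>V. subspace V \<Longrightarrow> V \<subseteq> E \<Longrightarrow> spanning_count V k = s (dim V)"
    and N: "dim E \<le> N"
  shows "point_set_count r k = (\<Sum>d\<le>N. subspace_count r d * s d)"
proof -
  let ?X = "{V \<in> {V. subspace V \<and> V \<subseteq> E}. \<rho> V = r}"
  let ?F = "\<lambda>V. {A. A \<subseteq> proj_space V \<and> card A = k \<and> span (\<Union>A) = V}"
  have finX: "finite ?X" by (rule finite_subset[OF _ finite_subspaces]) blast
  have "{A \<in> Pow (proj_space E). proj_rank \<rho> A = r \<and> card A = k} = (\<Union>V\<in>?X. ?F V)"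
  proof (intro set_eqI iffI)
    fix A assume A: "A \<in> {A \<in> Pow (proj_space E). proj_rank \<rho> A = r \<and> card A = k}"
    then have "span (\<Union>A) \<subseteq> E"
      by (intro span_minimal subspace_ground) (auto simp: proj_space_def)
    moreover have "A \<subseteq> proj_space (span (\<Union>A))"
      using A span_superset[of "\<Union>A"] by (auto simp: proj_space_def)
    ultimately show "A \<in> (\<Union>V\<in>?X. ?F V)" using A by (auto simp: proj_rank_def)
  next
    fix A assume "A \<in> (\<Union>V\<in>?X. ?F V)"
    then show "A \<in> {A \<in> Pow (proj_space E). proj_rank \<rho> A = r \<and> card A = k}"
      using proj_space_mono unfolding proj_rank_def by blast
  qed
  then have "point_set_count r k = card (\<Union>V\<in>?X. ?F V)"
    unfolding point_set_count_def by simp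
  \<comment> \<open>The union is disjoint because \<open>V\<close> is recovered from
    \<open>A\<close> as its span.\<close>
  also have "\<dots> = (\<Sum>V\<in>?X. spanning_count V k)"
    unfolding spanning_count_def
  proof (rule card_UN_disjoint[OF finX])
    show "\<forall>V\<in>?X. finite (?F V)"
    proof
      fix V assume "V \<in> ?X"
      then have "finite (proj_space V)"
        using finite_proj_space[OF finite_subset[OF _ finite_E]] by blast
      then show "finite (?F V)" by simp
    qed
  qed blast
  also have "\<dots> = (\<Sum>V\<in>?X. s (dim V))" by (rule sum.cong) (auto simp: s)
  also have "\<dots> = (\<Sum>d\<le>N. card {V \<in> ?X. dim V = d} * s d)"
  proof -
    have "dim ` ?X \<subseteq> {..N}"
      using dim_le_dim_finite[OF finite_E] N order_trans by blast
    from sum_fun_comp[OF finX finite_atMost this, of s] show ?thesis by simp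
  qed
  also have "\<dots> = (\<Sum>d\<le>N. subspace_count r d * s d)"
    unfolding subspace_count_def by (intro sum.cong) (simp_all add: conj_assoc)
  finally show ?thesis .
qed

end

section \<open>Equality of Whitney functions as equality of counts\<close>

lemma q_whitney_eq_iff:
  assumes "q_matroid scale1 E1 \<rho>1" and "q_matroid scale2 E2 \<rho>2"
  shows "vector_space.q_whitney scale1 E1 \<rho>1 = vector_space.q_whitney scale2 E2 \<rho>2 \<longleftrightarrow>
    (\<forall>r d. q_matroid.subspace_count scale1 E1 \<rho>1 r d = q_matroid.subspace_count scale2 E2 \<rho>2 r d)"
proof -
  interpret q1: q_matroid scale1 E1 \<rho>1 by fact
  interpret q2: q_matroid scale2 E2 \<rho>2 by fact
  show ?thesis
    unfolding q1.q_whitney_def q2.q_whitney_def q1.subspace_count_def q2.subspace_count_def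
  proof (rule whitney_sum_eq_iff)
    \<comment> \<open>The zero space serves as the member of rank 0; the top member is the ground
      space.\<close>
    show "{0} \<in> {V. q1.subspace V \<and> V \<subseteq> E1}" "{0} \<in> {V. q2.subspace V \<and> V \<subseteq> E2}"
      using q1.subspace_0[OF q1.subspace_ground] q2.subspace_0[OF q2.subspace_ground]
      by (simp_all add: q1.subspace_single_0 q2.subspace_single_0)
  qed (auto simp: q1.finite_subspaces q2.finite_subspaces q1.subspace_ground q2.subspace_ground
      q1.rank_mono q2.rank_mono q1.rank_le_dim q2.rank_le_dim q1.rank_zero q2.rank_zero)
qed

lemma whitney_proj_eq_iff:
  assumes "q_matroid scale1 E1 \<rho>1" and "q_matroid scale2 E2 \<rho>2"
  shows "whitney (vector_space.proj_space scale1 E1) (vector_space.proj_rank scale1 \<rho>1) =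
      whitney (vector_space.proj_space scale2 E2) (vector_space.proj_rank scale2 \<rho>2) \<longleftrightarrow>
    (\<forall>r k. q_matroid.point_set_count scale1 E1 \<rho>1 r k =
      q_matroid.point_set_count scale2 E2 \<rho>2 r k)"
proof -
  interpret q1: q_matroid scale1 E1 \<rho>1 by fact
  interpret q2: q_matroid scale2 E2 \<rho>2 by fact
  interpret m1: matroid "q1.proj_space E1" "q1.proj_rank \<rho>1" by (rule q1.matroid_projectivization)
  interpret m2: matroid "q2.proj_space E2" "q2.proj_rank \<rho>2" by (rule q2.matroid_projectivization)
  \<comment> \<open>The empty point set serves as the member of rank 0.\<close>
  have "q1.proj_rank \<rho>1 {} = 0" "q2.proj_rank \<rho>2 {} = 0"
    using m1.rank_le_card[of "{}"] m2.rank_le_card[of "{}"] by simp_all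
  then show ?thesis
    unfolding whitney_def q1.point_set_count_def q2.point_set_count_def
    by (intro whitney_sum_eq_iff[where ?o1.0 = "{}" and ?o2.0 = "{}"])
      (auto simp: m1.finite_ground m2.finite_ground m1.rank_le_card m2.rank_le_card
        m1.rank_mono m2.rank_mono)
qed

section \<open>Comparing the counts of two q-matroids\<close>

text \<open>With \<open>E1\<close> the larger space, every dimension occurring in either ground
  space is realised inside \<open>E1\<close>, so one matrix of spanning counts relates both pairs of
  counts.\<close>

lemma counts_determine_each_other:
  fixes scale1 :: "'a::{field, finite} \<Rightarrow> 'b::ab_group_add \<Rightarrow> 'b"
    and scale2 :: "'a \<Rightarrow> 'c::ab_group_add \<Rightarrow> 'c"
  assumes "q_matroid scale1 E1 \<rho>1" and "q_matroid scale2 E2 \<rho>2"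
    and dim: "vector_space.dim scale2 E2 \<le> vector_space.dim scale1 E1"
  shows "(\<forall>r d. q_matroid.subspace_count scale1 E1 \<rho>1 r d =
      q_matroid.subspace_count scale2 E2 \<rho>2 r d) \<longleftrightarrow>
    (\<forall>r k. q_matroid.point_set_count scale1 E1 \<rho>1 r k =
      q_matroid.point_set_count scale2 E2 \<rho>2 r k)"
proof -
  interpret q1: q_matroid scale1 E1 \<rho>1 by fact
  interpret q2: q_matroid scale2 E2 \<rho>2 by fact
  obtain V where V: "\<And>d. d \<le> q1.dim E1 \<Longrightarrow> q1.subspace (V d) \<and> V d \<subseteq> E1 \<and> q1.dim (V d) = d"
    and chain: "\<And>d e. d < e \<Longrightarrow> e \<le> q1.dim E1 \<Longrightarrow> V d \<subset> V e"
    using q1.subspace_chain_exists[OF q1.finite_E q1.subspace_ground] by blast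
  have finV: "finite (V d)" if "d \<le> q1.dim E1" for d
    using V[OF that] q1.finite_E finite_subset by blast
  \<comment> \<open>The common matrix, measured on the chain in \<open>E1\<close>.\<close>
  define s where "s k d = q1.spanning_count (V d) k" for k d
  have s1: "q1.spanning_count W k = s k (q1.dim W)" if W: "q1.subspace W" "W \<subseteq> E1" for W k
  proof -
    have d: "q1.dim W \<le> q1.dim E1" by (rule q1.dim_le_dim_finite[OF q1.finite_E W(2)])
    show ?thesis unfolding s_def
      by (rule spanning_count_eq)
        (use q1.vector_space_axioms q2.vector_space_axioms W V[OF d] finV[OF d] finite_subset[OF W(2) q1.finite_E] in auto)
  qed
  have s2: "q2.spanning_count W k = s k (q2.dim W)" if W: "q2.subspace W" "W \<subseteq> E2" for W k
  proof -
    have d: "q2.dim W \<le> q1.dim E1"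
      using q2.dim_le_dim_finite[OF q2.finite_E W(2)] dim by simp
    show ?thesis unfolding s_def
      by (rule spanning_count_eq)
        (use q1.vector_space_axioms q2.vector_space_axioms W V[OF d] finV[OF d] finite_subset[OF W(2) q2.finite_E] in auto)
  qed
  have P1: "q1.point_set_count r k = (\<Sum>d\<le>q1.dim E1. q1.subspace_count r d * s k d)" for r k
    by (rule q1.point_set_count_eq_sum) (use s1 in auto)
  have P2: "q2.point_set_count r k = (\<Sum>d\<le>q1.dim E1. q2.subspace_count r d * s k d)" for r k
    by (rule q2.point_set_count_eq_sum) (use s2 dim in auto)
  show ?thesis
  proof
    assume "\<forall>r d. q1.subspace_count r d = q2.subspace_count r d"
    then show "\<forall>r k. q1.point_set_count r k = q2.point_set_count r k"
      unfolding P1 P2 by simp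
  next
    assume eq: "\<forall>r k. q1.point_set_count r k = q2.point_set_count r k"
    show "\<forall>r d. q1.subspace_count r d = q2.subspace_count r d"
    proof (intro allI)
      fix r d
      show "q1.subspace_count r d = q2.subspace_count r d"
      proof (cases "d \<le> q1.dim E1")
        case True
        show ?thesis
        \<comment> \<open>Column \<open>\<pi> d\<close> is the number of points of
          \<open>V d\<close>; the arguments of \<open>s\<close> are swapped to put the row index
          first.\<close>
        proof (rule unitriangular_cancel[where s = "\<lambda>d k. s k d"
              and \<pi> = "\<lambda>d. card (q1.proj_space (V d))", OF _ _ _ True])
          fix k
          show "(\<Sum>d\<le>q1.dim E1. q1.subspace_count r d * s k d) =
              (\<Sum>d\<le>q1.dim E1. q2.subspace_count r d * s k d)"
            using eq unfolding P1 P2 by blast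
        next
          fix d assume "d \<le> q1.dim E1"
          then show "s (card (q1.proj_space (V d))) d = 1"
            unfolding s_def using V finV by (simp add: q1.spanning_count_card_proj_space)
        next
          fix d e assume de: "e < d" "d \<le> q1.dim E1"
          then have "card (q1.proj_space (V e)) < card (q1.proj_space (V d))"
            using V[of d] V[of e] finV chain by (intro q1.card_proj_space_less) auto
          then show "s (card (q1.proj_space (V d))) e = 0"
            unfolding s_def using de finV[of e] by (simp add: q1.spanning_count_eq_0)
        qed
      next
        \<comment> \<open>Such \<open>d\<close> exceeds both dimensions, so both counts are
          0.\<close>
        case False
        then show ?thesis
          using dim by (simp add: q1.subspace_count_eq_0 q2.subspace_count_eq_0)
      qed
    qed
  qed
qed

theorem theorem5p12:
  fixes scale1 :: "'a::{field, finite} \<Rightarrow> 'b::ab_group_add \<Rightarrow> 'b"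
    and scale2 :: "'a \<Rightarrow> 'c::ab_group_add \<Rightarrow> 'c"
    and E1 :: "'b set" and E2 :: "'c set"
    and \<rho>1 :: "'b set \<Rightarrow> nat" and \<rho>2 :: "'c set \<Rightarrow> nat"
  assumes "q_matroid scale1 E1 \<rho>1"
    and "q_matroid scale2 E2 \<rho>2"
  shows "vector_space.q_whitney scale1 E1 \<rho>1 = vector_space.q_whitney scale2 E2 \<rho>2 \<longleftrightarrow>
    whitney (vector_space.proj_space scale1 E1) (vector_space.proj_rank scale1 \<rho>1) =
    whitney (vector_space.proj_space scale2 E2) (vector_space.proj_rank scale2 \<rho>2)"
  unfolding q_whitney_eq_iff[OF assms] whitney_proj_eq_iff[OF assms]
  \<comment> \<open>The two dimensions are comparable, so one of the two orderings of the q-matroids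
    satisfies the dimension hypothesis.\<close>
  using counts_determine_each_other[OF assms] counts_determine_each_other[OF assms(2,1)]
  by (metis linear)

end
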